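(* Let $s=3$ and let $x\in[0,1]$. (1) If the asymptotic mean value of the ternary digits $r(x)$ exists and at least one of the frequencies $\nu_0(x)$, $\nu_1(x)$, $\nu_2(x)$ exists, then the other two frequencies of ternary digits of $x$ also exist. (2) If $r(x)$ exists but at least one of the frequencies $\nu_j(x)$, $j\in\{0,1,2\}$, does not exist, then the other two frequencies of ternary digits of $x$ also do not exist.
   Context: Every $x\in[0,1]$ has a ternary representation $x=\sum_{k\ge 1}\alpha_k 3^{-k}$ with $\alpha_k\in\{0,1,2\}$. If $x$ has two such representations, the one ending in zeros (period $(0)$) is used; the number $1$ has only the representation with all digits equal to $2$. Thus the $k$-th digit $\alpha_k(x)$ is well defined. For $i\in\{0,1,2\}$ put $N_i(x,k)=\#\{j\le k:\alpha_j(x)=i\}$. The frequency of digit $i$ in $x$ is $\nu_i(x)=\lim_{k\to\infty}N_i(x,k)/k$, if this limit exists (otherwise the frequency is said not to exist). The asymptotic mean value of the digits of $x$ is $r(x)=\lim_{n\to\infty}\frac1n\sum_{i=1}^n\alpha_i(x)$, if this limit exists. *)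

theory Defs
  imports Complex_Main
begin

text \<open>
  Digit sequences are indexed from 1, so that \<open>a k\<close> is the \<open>k\<close>-th digit. The entry \<open>a 0\<close> carries
  no information and is fixed to be 0, so that distinct representations are just distinct functions.
\<close>

definition ternary_rep :: "(nat \<Rightarrow> nat) \<Rightarrow> real \<Rightarrow> bool" where
  "ternary_rep a x \<longleftrightarrow>
     a 0 = 0 \<and> (\<forall>k\<ge>1. a k \<in> {0, 1, 2}) \<and> (\<lambda>k. real (a (Suc k)) / 3 ^ Suc k) sums x"

definition chosen_rep :: "(nat \<Rightarrow> nat) \<Rightarrow> real \<Rightarrow> bool" where
  "chosen_rep a x \<longleftrightarrow>
     ternary_rep a x \<and>
     ((\<exists>b. ternary_rep b x \<and> b \<noteq> a) \<longrightarrow> (\<exists>n. \<forall>k\<ge>n. a k = 0))"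

definition ternary_digit :: "real \<Rightarrow> nat \<Rightarrow> nat" where
  "ternary_digit x = (THE a. chosen_rep a x)"

definition digit_count :: "nat \<Rightarrow> real \<Rightarrow> nat \<Rightarrow> nat" where
  "digit_count i x k = card {j \<in> {1..k}. ternary_digit x j = i}"

definition has_digit_frequency :: "nat \<Rightarrow> real \<Rightarrow> real \<Rightarrow> bool" where
  "has_digit_frequency i x l \<longleftrightarrow> (\<lambda>k. real (digit_count i x k) / real k) \<longlonglongrightarrow> l"

definition has_digit_mean :: "real \<Rightarrow> real \<Rightarrow> bool" where
  "has_digit_mean x r \<longleftrightarrow> (\<lambda>n. (1 / real n) * (\<Sum>i = 1..n. real (ternary_digit x i))) \<longlonglongrightarrow> r"

end

theory Submission
  imports Defs
begin

text \<open>
  Two distinct ternary representations of the same number agree up to some place, after which one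
  continues with zeros only and the other with twos only; hence the choice of digits is well
  defined and the digits lie in {0, 1, 2}. Then \<open>N\<^sub>0 + N\<^sub>1 + N\<^sub>2 = k\<close> and
  \<open>N\<^sub>1 + 2 N\<^sub>2\<close> is the sum of the first \<open>k\<close> digits. If the mean converges, these two linear
  relations express any two of the frequencies through the third one.
\<close>

section \<open>Ternary representations and well-definedness of the digits\<close>

lemma ternary_rep_le_2:
  assumes "ternary_rep a x" "k \<ge> 1"
  shows "a k \<le> 2"
  using assms unfolding ternary_rep_def by fastforce

text \<open>At place \<open>m\<close> the sequence \<open>b\<close> gains at least
  \<open>1 / 3 ^ m\<close>, while the later digits of \<open>a\<close> can win back at most the sum
  of \<open>2 / 3 ^ k\<close> over \<open>k > m\<close>, which is exactly \<open>1 / 3 ^ m\<close>.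
  So there is no slack: each later pair of digits has the extreme difference.\<close>

lemma ternary_rep_first_difference:
  assumes a: "ternary_rep a x" and b: "ternary_rep b x"
    and agree: "\<And>k. k < m \<Longrightarrow> a k = b k" and less: "a m < b m" and "m < k"
  shows "a k = 2 \<and> b k = 0"
proof -
  have "m \<noteq> 0"
    using a b less unfolding ternary_rep_def by (intro notI) auto
  then obtain p where p: "m = Suc p"
    using not0_implies_Suc by blast
  define e where "e n = real (b (Suc n)) / 3 ^ Suc n - real (a (Suc n)) / 3 ^ Suc n" for n
  have "e sums (x - x)"
    unfolding e_def using a b unfolding ternary_rep_def by (intro sums_diff) auto
  then have "(\<lambda>n. e (n + Suc p)) sums (x - x - (\<Sum>i<Suc p. e i))"
    by (rule sums_split_initial_segment)
  moreover have "(\<Sum>i<p. e i) = 0"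
    by (rule sum.neutral) (auto simp: e_def agree p)
  ultimately have tail: "(\<lambda>n. e (n + Suc p)) sums (- e p)"
    by simp
  have "(\<lambda>n. (2 / 3 ^ Suc (Suc p)) * (1 / 3 :: real) ^ n)
      sums ((2 / 3 ^ Suc (Suc p)) * (1 / (1 - 1 / 3)))"
    by (intro sums_mult geometric_sums) auto
  \<comment> \<open>Adding the all-twos tail to the tail of \<open>e\<close> makes every term
    nonnegative, because \<open>2 - a k\<close> is never negative.\<close>
  then have "(\<lambda>n. 2 / 3 ^ Suc (n + Suc p)) sums (1 / 3 ^ Suc p :: real)"
    by (simp add: power_add field_simps)
  from sums_add [OF tail this]
  have h: "(\<lambda>n. e (n + Suc p) + 2 / 3 ^ Suc (n + Suc p)) sums (- e p + 1 / 3 ^ Suc p)" .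
  have h_eq: "e (n + Suc p) + 2 / 3 ^ Suc (n + Suc p)
      = (real (b (Suc (n + Suc p))) + (2 - real (a (Suc (n + Suc p))))) / 3 ^ Suc (n + Suc p)" for n
    by (simp add: e_def diff_divide_distrib add_divide_distrib)
  have a_le: "real (a (Suc n)) \<le> 2" for n
    using ternary_rep_le_2 [OF a, of "Suc n"] by simp
  have h_nonneg: "0 \<le> e (n + Suc p) + 2 / 3 ^ Suc (n + Suc p)" for n
    unfolding h_eq using a_le [of "n + Suc p"] by (intro divide_nonneg_pos) auto
  have "1 / 3 ^ Suc p \<le> (real (b (Suc p)) - real (a (Suc p))) / 3 ^ Suc p"
    using less p by (intro divide_right_mono) auto
  also have "\<dots> = e p"
    by (simp add: e_def diff_divide_distrib)
  finally have "- e p + 1 / 3 ^ Suc p \<le> 0"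
    by simp
  moreover have "0 \<le> - e p + 1 / 3 ^ Suc p"
    by (rule sums_le [OF h_nonneg sums_zero h])
  \<comment> \<open>The sum is squeezed to zero, so each of its nonnegative terms vanishes.\<close>
  ultimately have "(\<Sum>n. e (n + Suc p) + 2 / 3 ^ Suc (n + Suc p)) = 0"
    using sums_unique [OF h] by linarith
  then have h_zero: "e (n + Suc p) + 2 / 3 ^ Suc (n + Suc p) = 0" for n
    using suminf_eq_zero_iff [OF sums_summable [OF h] h_nonneg] by blast
  obtain n where k: "k = Suc (n + Suc p)"
    using \<open>m < k\<close> p less_imp_Suc_add by (metis add.commute)
  have "real (b k) + (2 - real (a k)) = 0"
    using h_zero [of n] unfolding h_eq k by simp
  then show ?thesis
    using a_le [of "n + Suc p"] k by simp
qed

lemma ternary_reps_distinct_obtain: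
  assumes "ternary_rep a x" "ternary_rep b x" "a \<noteq> b"
  obtains m where
    "(\<forall>k>m. a k = 2 \<and> b k = 0) \<or> (\<forall>k>m. b k = 2 \<and> a k = 0)"
proof -
  define m where "m = (LEAST k. a k \<noteq> b k)"
  have "\<exists>k. a k \<noteq> b k"
    using assms(3) by auto
  then have neq: "a m \<noteq> b m"
    unfolding m_def by (rule LeastI_ex)
  have agree: "a k = b k" if "k < m" for k
    using that not_less_Least unfolding m_def by blast
  show thesis
  proof (cases "a m < b m")
    case True
    then show thesis
      using ternary_rep_first_difference [OF assms(1,2) agree] that by blast
  next
    case False
    with neq have "b m < a m" by simp
    then show thesis
      using ternary_rep_first_difference [OF assms(2,1) agree [symmetric]] that by blast
  qed
qed

text \<open>For \<open>x < 1\<close> the digits are read off from the floors of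
  \<open>3 ^ n * x\<close>; the partial sums telescope to \<open>f n / 3 ^ n\<close>, which lies
  within \<open>(1 / 3) ^ n\<close> of \<open>x\<close>. The point 1 is separate because its floor
  at \<open>n = 0\<close> is already 1, so the telescoping would not start from 0.\<close>

lemma ternary_rep_exists:
  assumes "x \<in> {0..1}"
  shows "\<exists>a. ternary_rep a x"
proof (cases "x = 1")
  case True
  have "(\<lambda>n. (2 / 3) * (1 / 3 :: real) ^ n) sums ((2 / 3) * (1 / (1 - 1 / 3)))"
    by (intro sums_mult geometric_sums) auto
  then have "(\<lambda>n. 2 / 3 ^ Suc n) sums (1 :: real)"
    by (simp add: field_simps)
  then have "ternary_rep (\<lambda>k. if k = 0 then 0 else 2) x"
    using True by (simp add: ternary_rep_def)
  then show ?thesis by blast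
next
  case False
  with assms have x: "0 \<le> x" "x < 1" by auto
  define f where "f n = \<lfloor>3 ^ n * x\<rfloor>" for n :: nat
  have f0: "f 0 = 0"
    using x by (simp add: f_def floor_eq_iff)
  have f_bounds: "of_int (f n) \<le> 3 ^ n * x" "3 ^ n * x < of_int (f n) + 1" for n
    unfolding f_def by linarith+
  have step: "0 \<le> f (Suc n) - 3 * f n" "f (Suc n) - 3 * f n \<le> 2" for n
  proof -
    have "real_of_int (3 * f n) < real_of_int (f (Suc n) + 1)"
      using f_bounds(1) [of n] f_bounds(2) [of "Suc n"] by simp
    then show "0 \<le> f (Suc n) - 3 * f n"
      by linarith
    have "real_of_int (f (Suc n)) < real_of_int (3 * f n + 3)"
      using f_bounds(2) [of n] f_bounds(1) [of "Suc n"] by simp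
    then show "f (Suc n) - 3 * f n \<le> 2"
      by linarith
  qed
  define a where "a k = (if k = 0 then 0 else nat (f k - 3 * f (k - 1)))" for k
  have a_Suc: "real (a (Suc n)) = of_int (f (Suc n)) - 3 * of_int (f n)" for n
    using step(1) [of n] by (simp add: a_def)
  have partial: "(\<Sum>k<n. real (a (Suc k)) / 3 ^ Suc k) = of_int (f n) / 3 ^ n" for n
    by (induction n) (auto simp: f0 a_Suc field_simps)
  have "(\<lambda>n. of_int (f n) / 3 ^ n) \<longlonglongrightarrow> x"
  proof (rule tendsto_sandwich)
    have "x - (1 / 3) ^ n \<le> of_int (f n) / 3 ^ n" for n
    proof -
      have "x \<le> (of_int (f n) + 1) / 3 ^ n"
        using f_bounds(2) [of n] by (simp add: field_simps)
      then show ?thesis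
        by (simp add: power_one_over add_divide_distrib)
    qed
    then show "\<forall>\<^sub>F n in sequentially. x - (1 / 3) ^ n \<le> of_int (f n) / 3 ^ n"
      by simp
    have "of_int (f n) / 3 ^ n \<le> x" for n
      using f_bounds(1) [of n] by (simp add: field_simps)
    then show "\<forall>\<^sub>F n in sequentially. of_int (f n) / 3 ^ n \<le> x"
      by simp
    have "(\<lambda>n. x - (1 / 3) ^ n) \<longlonglongrightarrow> x - 0"
      by (intro tendsto_intros LIMSEQ_power_zero) auto
    then show "(\<lambda>n. x - (1 / 3) ^ n) \<longlonglongrightarrow> x"
      by simp
  qed simp
  then have "(\<lambda>k. real (a (Suc k)) / 3 ^ Suc k) sums x"
    unfolding sums_def partial .
  moreover have "a k \<in> {0, 1, 2}" if "k \<ge> 1" for k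
    using step [of "k - 1"] that by (auto simp: a_def)
  ultimately have "ternary_rep a x"
    by (simp add: ternary_rep_def a_def)
  then show ?thesis by blast
qed

text \<open>Two different chosen representations would both have to end in zeros, yet one of any two
  distinct representations ends in twos.\<close>

lemma chosen_rep_unique:
  assumes "chosen_rep a x" "chosen_rep b x"
  shows "a = b"
proof (rule ccontr)
  assume "a \<noteq> b"
  with assms obtain i j
    where zeros: "\<forall>k\<ge>i. a k = 0" "\<forall>k\<ge>j. b k = 0"
    unfolding chosen_rep_def by metis
  obtain m where "(\<forall>k>m. a k = 2 \<and> b k = 0) \<or> (\<forall>k>m. b k = 2 \<and> a k = 0)"
    using ternary_reps_distinct_obtain [of a x b] assms \<open>a \<noteq> b\<close>
    unfolding chosen_rep_def by blast
  \<comment> \<open>This index lies beyond all three thresholds \<open>m\<close>, \<open>i\<close>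
    and \<open>j\<close>.\<close>
  then have "a (Suc (m + i + j)) = 2 \<or> b (Suc (m + i + j)) = 2"
    by auto
  then show False
    using zeros by auto
qed

text \<open>A representation without rival is chosen automatically; otherwise one of two rivals ends
  in zeros and qualifies.\<close>

lemma chosen_rep_exists:
  assumes "x \<in> {0..1}"
  shows "\<exists>a. chosen_rep a x"
proof -
  obtain a where a: "ternary_rep a x"
    using ternary_rep_exists [OF assms] ..
  show ?thesis
  proof (cases "\<exists>b. ternary_rep b x \<and> b \<noteq> a")
    case True
    then obtain b where b: "ternary_rep b x" "a \<noteq> b"
      by blast
    obtain m where "(\<forall>k>m. a k = 2 \<and> b k = 0) \<or> (\<forall>k>m. b k = 2 \<and> a k = 0)"
      using ternary_reps_distinct_obtain [OF a b] by blast
    then have "(\<forall>k\<ge>Suc m. a k = 0) \<or> (\<forall>k\<ge>Suc m. b k = 0)"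
      by (auto simp: Suc_le_eq)
    then show ?thesis
      using a b(1) unfolding chosen_rep_def by blast
  next
    case False
    with a show ?thesis
      unfolding chosen_rep_def by blast
  qed
qed

lemma ternary_digit_le_2:
  assumes "x \<in> {0..1}" "k \<ge> 1"
  shows "ternary_digit x k \<le> 2"
proof -
  \<comment> \<open>Unique existence gives the definite description in \<open>ternary_digit\<close>
    its intended value.\<close>
  have "\<exists>!a. chosen_rep a x"
    using chosen_rep_exists [OF assms(1)] chosen_rep_unique by blast
  then have "chosen_rep (ternary_digit x) x"
    unfolding ternary_digit_def by (rule theI')
  then show ?thesis
    using ternary_rep_le_2 assms(2) unfolding chosen_rep_def by blast
qed

section \<open>Digit counts, the mean and the frequencies\<close>

lemma digit_count_Suc:
  "digit_count i x (Suc k) = digit_count i x k + (if ternary_digit x (Suc k) = i then 1 else 0)"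
proof -
  have "{j \<in> {1..Suc k}. ternary_digit x j = i} =
      (if ternary_digit x (Suc k) = i then insert (Suc k) {j \<in> {1..k}. ternary_digit x j = i}
       else {j \<in> {1..k}. ternary_digit x j = i})"
    by (auto simp: le_Suc_eq)
  then show ?thesis
    by (simp add: digit_count_def)
qed

lemma digit_count_relations:
  assumes "x \<in> {0..1}"
  shows "digit_count 0 x k + digit_count 1 x k + digit_count 2 x k = k"
    and "digit_count 1 x k + 2 * digit_count 2 x k = (\<Sum>i = 1..k. ternary_digit x i)"
proof (induction k)
  case 0
  case 1 show ?case by (simp add: digit_count_def)
  case 2 show ?case by (simp add: digit_count_def)
next
  case (Suc k)
  have "ternary_digit x (Suc k) \<in> {0, 1, 2}"
    using ternary_digit_le_2 [OF assms, of "Suc k"] by fastforce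
  then show "digit_count 0 x (Suc k) + digit_count 1 x (Suc k) + digit_count 2 x (Suc k) = Suc k"
    and "digit_count 1 x (Suc k) + 2 * digit_count 2 x (Suc k) = (\<Sum>i = 1..Suc k. ternary_digit x i)"
    using Suc.IH by (auto simp: digit_count_Suc)
qed

text \<open>The frequency of digit 1 serves as a pivot: it is obtained from the given one and the
  mean, and then yields first that of 2 and finally that of 0.\<close>

lemma digit_frequency_exists_transfer:
  assumes x: "x \<in> {0..1}" and mean: "has_digit_mean x r"
    and freq: "has_digit_frequency j x l" and ij: "j \<in> {0, 1, 2}" "i \<in> {0, 1, 2}"
  shows "\<exists>l'. has_digit_frequency i x l'"
proof -
  define F where "F i k = real (digit_count i x k) / real k" for i k
  define M where "M k = (1 / real k) * (\<Sum>i = 1..k. real (ternary_digit x i))" for k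
  have M: "M \<longlonglongrightarrow> r"
    using mean unfolding has_digit_mean_def M_def .
  have F: "F j \<longlonglongrightarrow> l"
    using freq unfolding has_digit_frequency_def F_def .
  \<comment> \<open>Only eventually: at \<open>k = 0\<close> division by zero makes the left side 0.
    The relation \<open>digit_sum\<close> below holds there too, both sides being 0.\<close>
  have total: "\<forall>\<^sub>F k in sequentially. F 0 k + F 1 k + F 2 k = 1"
    using eventually_gt_at_top [of 0]
  proof eventually_elim
    case (elim k)
    have "real (digit_count 0 x k) + real (digit_count 1 x k) + real (digit_count 2 x k) = real k"
      using arg_cong [OF digit_count_relations(1) [OF x, of k], of real] by simp
    with elim show ?case
      by (simp add: F_def flip: add_divide_distrib)
  qed
  have digit_sum: "F 1 k + 2 * F 2 k = M k" for k
    using arg_cong [OF digit_count_relations(2) [OF x, of k], of real]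
    by (simp add: F_def M_def flip: of_nat_sum add_divide_distrib)
  from ij(1) consider "j = 0" | "j = 1" | "j = 2" by blast
  then have "\<exists>l'. F 1 \<longlonglongrightarrow> l'"
  proof cases
    case 1
    \<comment> \<open>Eliminating \<open>F 2\<close>:
      \<open>F 1 = 2 * (F 1 + F 2) - (F 1 + 2 * F 2)\<close>, where the first bracket is
      \<open>1 - F 0\<close> and the second is \<open>M\<close>.\<close>
    have "(\<lambda>k. 2 * (1 - F 0 k) - M k) \<longlonglongrightarrow> 2 * (1 - l) - r"
      using F M 1 by (auto intro!: tendsto_intros)
    moreover have "\<forall>\<^sub>F k in sequentially. 2 * (1 - F 0 k) - M k = F 1 k"
      using total by eventually_elim (simp flip: digit_sum)
    ultimately show ?thesis
      using Lim_transform_eventually by blast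
  next
    case 2
    with F show ?thesis by blast
  next
    case 3
    have "(\<lambda>k. M k - 2 * F 2 k) \<longlonglongrightarrow> r - 2 * l"
      using F M 3 by (auto intro!: tendsto_intros)
    then show ?thesis
      by (auto simp flip: digit_sum)
  qed
  then obtain l1 where F1: "F 1 \<longlonglongrightarrow> l1" ..
  have "(\<lambda>k. (M k - F 1 k) / 2) \<longlonglongrightarrow> (r - l1) / 2"
    by (intro tendsto_intros M F1) simp
  then have F2: "F 2 \<longlonglongrightarrow> (r - l1) / 2"
    by (simp flip: digit_sum)
  have "(\<lambda>k. 1 - F 1 k - F 2 k) \<longlonglongrightarrow> 1 - l1 - (r - l1) / 2"
    by (intro tendsto_intros F1 F2)
  moreover have "\<forall>\<^sub>F k in sequentially. 1 - F 1 k - F 2 k = F 0 k"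
    using total by eventually_elim simp
  ultimately have F0: "F 0 \<longlonglongrightarrow> 1 - l1 - (r - l1) / 2"
    by (rule Lim_transform_eventually)
  show ?thesis
    using ij(2) F0 F1 F2 unfolding has_digit_frequency_def F_def by blast
qed

theorem theorem2:
  fixes x :: real
  assumes "x \<in> {0..1}"
  shows "((\<exists>r. has_digit_mean x r) \<longrightarrow>
           (\<forall>j\<in>{0, 1, 2}. (\<exists>l. has_digit_frequency j x l) \<longrightarrow>
             (\<forall>i\<in>{0, 1, 2} - {j}. \<exists>l. has_digit_frequency i x l))) \<and>
         ((\<exists>r. has_digit_mean x r) \<longrightarrow>
           (\<forall>j\<in>{0, 1, 2}. (\<nexists>l. has_digit_frequency j x l) \<longrightarrow>
             (\<forall>i\<in>{0, 1, 2} - {j}. \<nexists>l. has_digit_frequency i x l)))"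
  \<comment> \<open>The second claim is the contrapositive of the transfer with \<open>i\<close> and
    \<open>j\<close> interchanged.\<close>
  using digit_frequency_exists_transfer [OF assms] by (metis Diff_iff)

end
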